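(* Let $k$ be an even integer with $2\leq k\leq p-3$, assume that $p\mid B_k$, and put $\epsilon=w^{k-2}$. Let $f'$ be any non-zero cusp form of weight 2 and type $\epsilon$ which is an eigenform for all Hecke operators $T_n$ with $(n,p)=1$, and such that for every prime $l\neq p$ the eigenvalue $\lambda_l$ of $T_l$ on $f'$ satisfies $\lambda_l\equiv1+l^{k-1}\equiv1+\epsilon(l)l\pmod{\wp_L}$, where $\wp_L$ is a prime (independent of $l$) lying over $\wp$ in the field $L$ generated over $\mathbb{Q}(\mu_{p-1})$ by the eigenvalues of the $T_n$, $(n,p)=1$, on $f'$. Then $f'$ is an eigenform for all Hecke operators $T_n$, $n\ge1$ (including those for which $p\mid n$). Hence, after replacing $f'$ by a suitable multiple of $f'$, we have $$f'=\sum_{n=1}^{\infty}\lambda_nq^n,\qquad\text{where } T_n(f')=\lambda_nf' \text{ for all } n\ge1.$$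
   Context: $p$ is an odd prime, $\mu_{p-1}$ is the group of $(p-1)$-th roots of unity in $\mathbb{C}$, and $\wp$ is a fixed prime of $\mathbb{Q}(\mu_{p-1})$ lying above $p$. The Teichmuller character is the character $w:(\mathbb{Z}/p\mathbb{Z})^\times\to\mu_{p-1}$ with $w(n)\equiv n\pmod{\wp}$ for $(n,p)=1$. The Bernoulli numbers are defined by $\frac{t}{e^t-1}=\sum_{n\ge0}B_n\frac{t^n}{n!}$; "$p\mid B_k$" means that $p$ divides the numerator of $B_k$. Characters of $(\mathbb{Z}/p\mathbb{Z})^\times$ are extended to $\mathbb{Z}$ by $0$ on multiples of $p$. A cusp form of weight 2 and type $\epsilon$ is a cusp form $f$ of weight 2 for $\Gamma_1(p)$ (vanishing at all cusps) such that $(cz+d)^{-2}f\big(\frac{az+b}{cz+d}\big)=\epsilon(d)f(z)$ for all $\begin{pmatrix}a&b\\c&d\end{pmatrix}\in\Gamma_0(p)$. $T_n$ are the usual Hecke operators for $\Gamma_1(p)$: on weight 2, type $\epsilon$ forms $f=\sum a_nq^n$ ($q=e^{2\pi iz}$), for $l$ prime, $T_lf=\sum_n\big(a_{nl}+\epsilon(l)\,l\,a_{n/l}\big)q^n$ (with $a_{n/l}=0$ if $l\nmid n$; in particular $T_pf=\sum_n a_{np}q^n$), $T_1=\mathrm{id}$, $T_{l^{r+1}}=T_lT_{l^r}-l\,\epsilon(l)T_{l^{r-1}}$ for $r\ge1$, and $T_{mn}=T_mT_n$ for $\gcd(m,n)=1$. *)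

theory Defs
  imports
    "HOL-Complex_Analysis.Complex_Analysis"
    "HOL-Algebra.Algebraic_Closure_Type"
    "HOL-Algebra.Generated_Fields"
    "HOL-Computational_Algebra.Computational_Algebra"
begin

section \<open>Bernoulli numbers\<close>

definition bernoulli :: "nat \<Rightarrow> rat" where
  "bernoulli n = fact n * fps_nth (fps_X / (fps_exp 1 - 1)) n"

lemma fps_exp_minus_1_nonzero: "fps_exp 1 - 1 \<noteq> (0::rat fps)"
proof
  assume "fps_exp 1 - 1 = (0::rat fps)"
  hence "fps_nth (fps_exp 1 - 1) 1 = (0::rat)" by simp
  thus False by simp
qed

lemma bernoulli_generating_function: "Abs_fps (\<lambda>n. bernoulli n / fact n) * (fps_exp 1 - 1) = fps_X"
proof -
  have "subdegree (fps_exp 1 - 1 :: rat fps) \<le> 1"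
    by (rule subdegree_leI) simp
  then have "(fps_exp 1 - 1 :: rat fps) dvd fps_X"
    using fps_exp_minus_1_nonzero by (subst fps_dvd_iff) auto
  moreover have "Abs_fps (\<lambda>n. bernoulli n / fact n) = fps_X / (fps_exp 1 - 1)"
    by (rule fps_ext) (simp add: bernoulli_def)
  ultimately show ?thesis by simp
qed


section \<open>Subfields of the complex numbers and their primes\<close>

abbreviation complex_ring :: "complex ring" where
  "complex_ring \<equiv> ring_of_type_algebra"

definition cyclotomic_field :: "nat \<Rightarrow> complex set" where
  "cyclotomic_field m = generate_field complex_ring {z. z ^ m = 1}"

definition integers_of :: "complex set \<Rightarrow> complex set" where
  "integers_of K = {x \<in> K. algebraic_int x}"

definition prime_of_field :: "complex set \<Rightarrow> complex set \<Rightarrow> bool" where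
  "prime_of_field K P \<longleftrightarrow>
     primeideal P (complex_ring\<lparr>carrier := integers_of K\<rparr>) \<and> P \<noteq> {0}"

definition prime_above :: "nat \<Rightarrow> complex set \<Rightarrow> complex set \<Rightarrow> bool" where
  "prime_above p K P \<longleftrightarrow> prime_of_field K P \<and> of_nat p \<in> P"

definition prime_lies_over ::
  "complex set \<Rightarrow> complex set \<Rightarrow> complex set \<Rightarrow> complex set \<Rightarrow> bool" where
  "prime_lies_over K P L PL \<longleftrightarrow> prime_of_field L PL \<and> PL \<inter> integers_of K = P"

text \<open>The congruence forces \<open>x - y\<close> to be an algebraic integer, as \<open>I\<close> consists of such numbers.\<close>

definition cong_ideal :: "complex \<Rightarrow> complex \<Rightarrow> complex set \<Rightarrow> bool" where
  "cong_ideal x y I \<longleftrightarrow> x - y \<in> I"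


section \<open>Characters\<close>

text \<open>Characters of \<open>(\<int>/N\<int>)\<^sup>\<times>\<close>, extended to \<open>\<int>\<close> by zero.\<close>

definition dirichlet_char :: "nat \<Rightarrow> (int \<Rightarrow> complex) \<Rightarrow> bool" where
  "dirichlet_char N ch \<longleftrightarrow>
     (\<forall>n. ch (n + int N) = ch n) \<and>
     (\<forall>m n. ch (m * n) = ch m * ch n) \<and>
     ch 1 = 1 \<and>
     (\<forall>n. ch n = 0 \<longleftrightarrow> \<not> coprime n (int N))"

definition teichmuller_char :: "nat \<Rightarrow> complex set \<Rightarrow> (int \<Rightarrow> complex) \<Rightarrow> bool" where
  "teichmuller_char p P w \<longleftrightarrow>
     dirichlet_char p w \<and>
     (\<forall>n. coprime n (int p) \<longrightarrow> w n ^ (p - 1) = 1 \<and> cong_ideal (w n) (of_int n) P)"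

text \<open>The case distinction matters for \<open>m = 0\<close>: the trivial character also vanishes at
  integers not coprime to the modulus, whereas \<open>0 ^ 0 = 1\<close>.\<close>

definition char_power :: "nat \<Rightarrow> (int \<Rightarrow> complex) \<Rightarrow> nat \<Rightarrow> int \<Rightarrow> complex" where
  "char_power N ch m n = (if coprime n (int N) then ch n ^ m else 0)"


section \<open>Cusp forms of weight 2\<close>

text \<open>Modular forms are total functions on \<open>\<complex>\<close>; only their values on the upper half-plane
  are relevant. A matrix with rows \<open>(a, b)\<close> and \<open>(c, d)\<close> is the quadruple \<open>(a, b, c, d)\<close>.\<close>

type_synonym mat2 = "int \<times> int \<times> int \<times> int"

definition upper_half_plane :: "complex set" where
  "upper_half_plane = {z. Im z > 0}"

definition SL2Z :: "mat2 set" where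
  "SL2Z = {(a, b, c, d). a * d - b * c = 1}"

definition Gamma0 :: "nat \<Rightarrow> mat2 set" where
  "Gamma0 N = {(a, b, c, d). (a, b, c, d) \<in> SL2Z \<and> int N dvd c}"

definition Gamma1 :: "nat \<Rightarrow> mat2 set" where
  "Gamma1 N = {(a, b, c, d). (a, b, c, d) \<in> Gamma0 N \<and> int N dvd (a - 1) \<and> int N dvd (d - 1)}"

fun slash2 :: "(complex \<Rightarrow> complex) \<Rightarrow> mat2 \<Rightarrow> complex \<Rightarrow> complex" where
  "slash2 f (a, b, c, d) z =
     f ((of_int a * z + of_int b) / (of_int c * z + of_int d)) / (of_int c * z + of_int d) ^ 2"

text \<open>Every cusp is of the form \<open>\<gamma>\<infinity>\<close> with \<open>\<gamma>\<close> in \<open>SL\<^sub>2(\<int>)\<close>, and the value there is the limit of the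
  transformed function as \<open>Im z\<close> tends to infinity, uniformly in \<open>Re z\<close>. For invariant holomorphic
  functions, the existence of this limit already entails holomorphy at the cusp.\<close>

definition vanishes_at_cusps :: "(complex \<Rightarrow> complex) \<Rightarrow> bool" where
  "vanishes_at_cusps f \<longleftrightarrow> (\<forall>\<gamma>\<in>SL2Z. (slash2 f \<gamma> \<longlongrightarrow> 0) (filtercomap Im at_top))"

definition cusp_form2_Gamma1 :: "nat \<Rightarrow> (complex \<Rightarrow> complex) \<Rightarrow> bool" where
  "cusp_form2_Gamma1 N f \<longleftrightarrow>
     f holomorphic_on upper_half_plane \<and>
     (\<forall>\<gamma>\<in>Gamma1 N. \<forall>z\<in>upper_half_plane. slash2 f \<gamma> z = f z) \<and>
     vanishes_at_cusps f"

definition cusp_form2 :: "nat \<Rightarrow> (int \<Rightarrow> complex) \<Rightarrow> (complex \<Rightarrow> complex) \<Rightarrow> bool" where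
  "cusp_form2 N \<epsilon> f \<longleftrightarrow>
     cusp_form2_Gamma1 N f \<and>
     (\<forall>a b c d. (a, b, c, d) \<in> Gamma0 N \<longrightarrow>
        (\<forall>z\<in>upper_half_plane. slash2 f (a, b, c, d) z = \<epsilon> d * f z))"


section \<open>Hecke operators in weight 2\<close>

definition q_param :: "complex \<Rightarrow> complex" where
  "q_param z = exp (2 * of_real pi * \<i> * z)"

definition has_q_expansion :: "(complex \<Rightarrow> complex) \<Rightarrow> (nat \<Rightarrow> complex) \<Rightarrow> bool" where
  "has_q_expansion f a \<longleftrightarrow> (\<forall>z\<in>upper_half_plane. (\<lambda>n. a n * q_param z ^ n) sums f z)"

definition q_coeff :: "(complex \<Rightarrow> complex) \<Rightarrow> nat \<Rightarrow> complex" where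
  "q_coeff f = (THE a. has_q_expansion f a)"

definition hecke_prime ::
  "(int \<Rightarrow> complex) \<Rightarrow> nat \<Rightarrow> (complex \<Rightarrow> complex) \<Rightarrow> complex \<Rightarrow> complex" where
  "hecke_prime \<epsilon> l f z =
     (\<Sum>n. (q_coeff f (n * l) +
            \<epsilon> (int l) * of_nat l * (if l dvd n then q_coeff f (n div l) else 0)) * q_param z ^ n)"

fun hecke_prime_power ::
  "(int \<Rightarrow> complex) \<Rightarrow> nat \<Rightarrow> nat \<Rightarrow> (complex \<Rightarrow> complex) \<Rightarrow> complex \<Rightarrow> complex" where
  "hecke_prime_power \<epsilon> l 0 f = f"
| "hecke_prime_power \<epsilon> l (Suc 0) f = hecke_prime \<epsilon> l f"
| "hecke_prime_power \<epsilon> l (Suc (Suc r)) f =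
     (\<lambda>z. hecke_prime \<epsilon> l (hecke_prime_power \<epsilon> l (Suc r) f) z
            - of_nat l * \<epsilon> (int l) * hecke_prime_power \<epsilon> l r f z)"

text \<open>\<open>T\<^sub>n\<close> is the composition of the \<open>T\<^bsub>l^r\<^esub>\<close> over the prime powers exactly dividing \<open>n\<close>. The
  operators for distinct primes commute on modular forms, so that the order of composition chosen
  here is immaterial.\<close>

definition hecke ::
  "(int \<Rightarrow> complex) \<Rightarrow> nat \<Rightarrow> (complex \<Rightarrow> complex) \<Rightarrow> complex \<Rightarrow> complex" where
  "hecke \<epsilon> n f =
     foldr (\<lambda>l. hecke_prime_power \<epsilon> l (multiplicity l n)) (sorted_list_of_set (prime_factors n)) f"

lemma hecke_1: "hecke \<epsilon> 1 f = f"
  by (simp add: hecke_def)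

lemma hecke_prime_pow:
  assumes "Factorial_Ring.prime l"
  shows "hecke \<epsilon> (l ^ r) f = hecke_prime_power \<epsilon> l r f"
proof (cases "r = 0")
  case False
  then have "prime_factors (l ^ r) = {l}"
    using assms by (simp add: prime_factorization_prime_power)
  then show ?thesis
    using assms by (simp add: hecke_def)
qed (simp add: hecke_1[unfolded One_nat_def])

definition hecke_eigenvalue ::
  "(int \<Rightarrow> complex) \<Rightarrow> nat \<Rightarrow> (complex \<Rightarrow> complex) \<Rightarrow> complex \<Rightarrow> bool" where
  "hecke_eigenvalue \<epsilon> n f c \<longleftrightarrow> (\<forall>z\<in>upper_half_plane. hecke \<epsilon> n f z = c * f z)"

end

theory Submission
  imports Defs "HOL-Real_Asymp.Real_Asymp"
begin

text \<open>
  Let \<open>f = \<Sum> a\<^sub>n q\<^sup>n\<close> be the given form. What makes every Hecke eigenform away from \<open>p\<close> an eigenform at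
  \<open>p\<close> as well is that there are no oldforms: at level \<open>p\<close> they could only come from level 1, and
  there is no non-zero cusp form of weight 2 and level 1.

  The level 1 statement (\<open>level_one_vanishing\<close>) is proved with the primitive \<open>G\<close> of the form: its
  invariance under \<open>z \<mapsto> z + 1\<close> and invariance up to a constant under \<open>z \<mapsto> z / (z + 1)\<close> give invariance
  under \<open>z \<mapsto> - 1 / z\<close>, and then \<open>G\<close>, as a function of \<open>q\<close>, attains its maximum modulus over a closed disc
  at an interior point, so it is constant.

  From this, a function \<open>h = \<Sum> b\<^sub>n q\<^sup>n\<close> without constant term that transforms correctly under the matrix
  with rows \<open>(1, 0)\<close>, \<open>(p, 1)\<close> vanishes as soon as \<open>b\<^sub>n = 0\<close> for all \<open>n\<close> prime to \<open>p\<close>, because then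
  \<open>h (z / p)\<close> has level 1 (\<open>vanishing_if_supported_on_multiples\<close>). If \<open>h\<close> is moreover an eigenfunction
  of the \<open>T\<^sub>l\<close> with \<open>l \<noteq> p\<close>, then the recursion for its coefficients shows that \<open>b\<^sub>1 = 0\<close> suffices
  (\<open>hecke_coeff_eigen_vanishing\<close>). This is used twice. For \<open>h = f\<close> it gives \<open>a\<^sub>1 \<noteq> 0\<close>. For
  \<open>h = T\<^sub>p f - (a\<^sub>p / a\<^sub>1) f\<close>, which has the same eigenvalues as \<open>f\<close> and vanishing first coefficient, it
  gives \<open>T\<^sub>p f = (a\<^sub>p / a\<^sub>1) f\<close> (\<open>hecke_eigen_at_level\<close>); here \<open>T\<^sub>p\<close> is averaging over the points
  \<open>(z + j) / p\<close>.

  Finally the recursions that define \<open>T\<^sub>n\<close> from the \<open>T\<^sub>l\<close> are the ones satisfied by the \<open>a\<^sub>n / a\<^sub>1\<close>, so that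
  \<open>T\<^sub>n f = (a\<^sub>n / a\<^sub>1) f\<close> for all \<open>n\<close>, and \<open>f / a\<^sub>1\<close> is the normalised multiple.
\<close>

section \<open>Existence and uniqueness of q-expansions\<close>

lemma norm_q_param: "norm (q_param z) = exp (- (2 * pi * Im z))"
  by (simp add: q_param_def)

lemma q_param_nonzero [simp]: "q_param z \<noteq> 0"
  by (simp add: q_param_def)

lemma norm_q_param_less_1: "z \<in> upper_half_plane \<Longrightarrow> norm (q_param z) < 1"
  by (simp add: norm_q_param upper_half_plane_def)

lemma q_param_add: "q_param (z + z') = q_param z * q_param z'"
  by (simp add: q_param_def algebra_simps exp_add)

lemma q_param_mult: "q_param (of_nat n * z) = q_param z ^ n"
  by (simp add: q_param_def mult_ac flip: exp_of_nat_mult)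

lemma q_param_divide: "0 < m \<Longrightarrow> q_param (z / of_nat m) ^ m = q_param z"
  by (simp flip: q_param_mult)

lemma q_param_add_1: "q_param (z + 1) = q_param z"
  by (simp add: q_param_add) (simp add: q_param_def)

lemma q_param_Ln: "w \<noteq> 0 \<Longrightarrow> q_param (Ln w / (2 * of_real pi * \<i>)) = w"
  by (simp add: q_param_def)

lemma Im_Ln_normalised:
  "w \<noteq> 0 \<Longrightarrow> Im (Ln w / (2 * of_real pi * \<i>)) = - ln (norm w) / (2 * pi)"
  using Re_Ln [of w] by (simp add: Im_divide power2_eq_square)

text \<open>This turns statements about all points of the upper half-plane into statements about the punctured unit
  disc; the logarithm provides the preimage.\<close>

lemma q_param_onto:
  assumes "w \<noteq> 0" "norm w < 1"
  obtains z where "z \<in> upper_half_plane" "q_param z = w"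
proof
  show "Ln w / (2 * of_real pi * \<i>) \<in> upper_half_plane"
    using assms Im_Ln_normalised [of w] by (simp add: upper_half_plane_def divide_neg_pos)
qed (use assms in \<open>simp add: q_param_Ln\<close>)

text \<open>The q-parameter misses the centre of the disc. Multiplying the series by \<open>w\<close> makes it vanish at the
  centre too, after which isolation of zeros applies.\<close>

lemma power_series_zero_off_centre:
  fixes a :: "nat \<Rightarrow> complex"
  assumes "\<And>w. w \<noteq> 0 \<Longrightarrow> norm w < 1 \<Longrightarrow> (\<lambda>n. a n * w ^ n) sums 0"
  shows "a n = 0"
proof (rule ccontr)
  assume nz: "a n \<noteq> 0"
  define b where "b n = (case n of 0 \<Rightarrow> 0 | Suc m \<Rightarrow> a m)" for n
  have "(\<lambda>n. b n * (w - 0) ^ n) sums 0" if "norm (w - 0) < 1" for w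
  proof (cases "w = 0")
    case True
    then show ?thesis by (simp add: b_def)
  next
    case False
    then have "(\<lambda>n. w * (a n * w ^ n)) sums (w * 0)"
      using assms [of w] that by (intro sums_mult) auto
    then show ?thesis
      using sums_Suc_iff [of "\<lambda>n. b n * w ^ n" 0] by (simp add: b_def mult_ac)
  qed
  moreover have "b (Suc n) \<noteq> 0"
    using nz by (simp add: b_def)
  ultimately obtain s where s: "0 < s" "\<And>z::complex. z \<in> cball 0 s - {0} \<Longrightarrow> (0::complex) \<noteq> 0"
    using powser_0_nonzero [of 1 0 b "\<lambda>_. 0" "Suc n"] by auto
  show False
    using s(1) s(2) [of "of_real s"] by auto
qed

lemma has_q_expansion_unique:
  assumes "has_q_expansion f a" "has_q_expansion f b"
  shows "a = b"
proof
  fix n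
  have "(\<lambda>n. (a n - b n) * w ^ n) sums 0" if w: "w \<noteq> 0" "norm w < 1" for w
  proof -
    obtain z where "z \<in> upper_half_plane" "q_param z = w"
      using q_param_onto [OF w] by blast
    then have "(\<lambda>n. a n * w ^ n) sums f z" "(\<lambda>n. b n * w ^ n) sums f z"
      using assms by (auto simp: has_q_expansion_def)
    from sums_diff [OF this] show ?thesis
      by (simp add: algebra_simps)
  qed
  from power_series_zero_off_centre [of "\<lambda>n. a n - b n", OF this] show "a n = b n"
    by simp
qed

lemma q_coeff_eqI: "has_q_expansion f a \<Longrightarrow> q_coeff f = a"
  unfolding q_coeff_def by (blast intro: has_q_expansion_unique)

lemma has_q_expansion_summable:
  assumes "has_q_expansion f a" "norm w < 1"
  shows "summable (\<lambda>n. a n * w ^ n)"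
proof (cases "w = 0")
  case False
  then obtain z where "z \<in> upper_half_plane" "q_param z = w"
    using q_param_onto [OF _ assms(2)] by blast
  then show ?thesis
    using assms(1) unfolding has_q_expansion_def sums_def summable_def by blast
qed (metis powser_sums_zero sums_summable)

lemma has_q_expansion_summable_norm:
  assumes "has_q_expansion f a" "norm w < 1"
  shows "summable (\<lambda>n. norm (a n * w ^ n))"
proof -
  obtain r where r: "norm w < r" "r < 1"
    using dense assms(2) by blast
  then have "norm (of_real r :: complex) = r"
    using norm_ge_zero [of w] by (simp del: norm_ge_zero)
  then show ?thesis
    using r by (intro powser_insidea [where x = "of_real r"] has_q_expansion_summable [OF assms(1)]) auto
qed

text \<open>Periodicity makes \<open>f\<close> a function \<open>\<Phi>\<close> of \<open>q\<close> on the punctured disc, and decay at \<open>\<i>\<infinity>\<close> makes the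
  singularity of \<open>\<Phi>\<close> at \<open>0\<close> removable; the expansion is the Taylor series of \<open>\<Phi>\<close>.\<close>

lemma q_expansion_exists:
  assumes hol: "f holomorphic_on upper_half_plane"
    and per: "\<And>z. z \<in> upper_half_plane \<Longrightarrow> f (z + 1) = f z"
    and van: "(f \<longlongrightarrow> 0) (filtercomap Im at_top)"
  obtains a where "a 0 = 0" "has_q_expansion f a"
proof -
  define \<Phi> where "\<Phi> w = (if w = 0 then 0 else f (Ln w / (2 * of_real pi * \<i>)))" for w
  have per_nat: "f (z + of_nat n) = f z" if "z \<in> upper_half_plane" for z n
  proof (induction n)
    case (Suc n)
    have "z + of_nat n \<in> upper_half_plane"
      using that by (simp add: upper_half_plane_def)
    from per [OF this] Suc show ?case
      by (simp add: algebra_simps)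
  qed simp
  have per_int: "f (z + of_int n) = f z" if "z \<in> upper_half_plane" for z n
  proof (cases n)
    case (neg m)
    have "z + of_int n \<in> upper_half_plane"
      using that by (simp add: upper_half_plane_def)
    from per_nat [OF this, of "Suc m"] neg show ?thesis
      by simp
  qed (use per_nat that in auto)
  have \<Phi>_q: "\<Phi> (q_param z) = f z" if "z \<in> upper_half_plane" for z
  proof -
    have "exp (Ln (q_param z)) = exp (2 * of_real pi * \<i> * z)"
      by (simp add: q_param_def)
    then obtain n :: int where "Ln (q_param z) = 2 * of_real pi * \<i> * z + of_int (2 * n) * pi * \<i>"
      unfolding exp_eq by auto
    then have "Ln (q_param z) / (2 * of_real pi * \<i>) = z + of_int n"
      by (simp add: field_simps)
    then show ?thesis
      using per_int [OF that] by (simp add: \<Phi>_def)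
  qed
  have punctured: "\<Phi> holomorphic_on (ball 0 1 - {0})"
  proof (rule holomorphic_onI)
    fix w0 :: complex
    assume "w0 \<in> ball 0 1 - {0}"
    then have w0: "w0 \<noteq> 0" "norm w0 < 1" by auto
    obtain z0 where z0: "z0 \<in> upper_half_plane" "q_param z0 = w0"
      using q_param_onto [OF w0] by blast
    \<comment> \<open>Expanding around \<open>w0\<close> keeps the argument of the logarithm near \<open>1\<close>, hence off the branch cut.\<close>
    define g where "g w = z0 + Ln (w / w0) / (2 * of_real pi * \<i>)" for w
    define U where "U = (ball 0 1 - {0}) \<inter> (\<lambda>w. w / w0) -` (- \<real>\<^sub>\<le>\<^sub>0)"
    have U: "open U"
      unfolding U_def using w0
      by (intro open_Int open_Diff open_vimage continuous_intros) auto
    have g: "g w \<in> upper_half_plane" "\<Phi> w = f (g w)" if "w \<in> U" for w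
    proof -
      have w: "w \<noteq> 0" "norm w < 1" using that by (auto simp: U_def)
      have q: "q_param (g w) = w"
        using w w0 z0 by (simp add: g_def q_param_add q_param_Ln)
      then have "norm (q_param (g w)) < 1" using w by simp
      then show "g w \<in> upper_half_plane"
        by (simp add: norm_q_param upper_half_plane_def zero_less_mult_iff)
      from \<Phi>_q [OF this] q show "\<Phi> w = f (g w)" by simp
    qed
    have "g holomorphic_on U"
      unfolding g_def U_def using w0 by (intro holomorphic_intros) auto
    then have "(f \<circ> g) holomorphic_on U"
      using hol g by (intro holomorphic_on_compose_gen [where t = upper_half_plane]) auto
    then have "\<Phi> holomorphic_on U"
      using g by (subst holomorphic_cong [where g = "f \<circ> g"]) auto
    moreover have "w0 \<in> U"
      using w0 by (simp add: U_def)
    ultimately show "\<Phi> field_differentiable at w0 within (ball 0 1 - {0})"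
      using U holomorphic_on_imp_differentiable_at field_differentiable_at_within by blast
  qed
  have centre: "(\<Phi> \<longlongrightarrow> \<Phi> z) (at z within ball 0 1)" if "z \<in> {0}" for z
  proof -
    have "filterlim (\<lambda>r. - ln r / (2 * pi)) at_top (at_right 0)"
      by real_asymp
    moreover have "filterlim norm (at_right 0) (at (0 :: complex))"
      by (auto simp: filterlim_at eventually_at_filter intro!: tendsto_eq_intros)
    ultimately have "filterlim (\<lambda>w::complex. - ln (norm w) / (2 * pi)) at_top (at 0)"
      by (rule filterlim_compose)
    moreover have "\<forall>\<^sub>F w in at 0. - ln (norm w) / (2 * pi) = Im (Ln w / (2 * of_real pi * \<i>))"
      using Im_Ln_normalised by (auto simp: eventually_at_filter)
    ultimately have "filterlim (\<lambda>w. Im (Ln w / (2 * of_real pi * \<i>))) at_top (at 0)"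
      by (subst (asm) filterlim_cong [OF refl refl]) auto
    then have "filterlim (\<lambda>w. Ln w / (2 * of_real pi * \<i>)) (filtercomap Im at_top) (at 0)"
      by (simp add: filterlim_filtercomap_iff o_def)
    from filterlim_compose [OF van this]
    have "((\<lambda>w. f (Ln w / (2 * of_real pi * \<i>))) \<longlongrightarrow> 0) (at 0)" .
    moreover have "\<forall>\<^sub>F w in at 0. f (Ln w / (2 * of_real pi * \<i>)) = \<Phi> w"
      by (auto simp: \<Phi>_def eventually_at_filter)
    ultimately have "(\<Phi> \<longlongrightarrow> 0) (at 0)"
      by (rule Lim_transform_eventually)
    then show ?thesis
      using that by (auto simp: \<Phi>_def intro: tendsto_within_subset)
  qed
  have hol\<Phi>: "\<Phi> holomorphic_on ball 0 1"
    using no_isolated_singularity' [OF centre punctured] by simp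
  define a where "a n = (deriv ^^ n) \<Phi> 0 / fact n" for n
  show thesis
  proof
    show "a 0 = 0"
      by (simp add: a_def \<Phi>_def)
    show "has_q_expansion f a"
      unfolding has_q_expansion_def
    proof
      fix z assume z: "z \<in> upper_half_plane"
      then have "q_param z \<in> ball 0 1"
        using norm_q_param_less_1 by simp
      from holomorphic_power_series [OF hol\<Phi> this] \<Phi>_q [OF z]
      show "(\<lambda>n. a n * q_param z ^ n) sums f z"
        by (simp add: a_def)
    qed
  qed
qed

section \<open>Operations on q-expansions\<close>

text \<open>The action of \<open>T\<^sub>l\<close> transported to coefficient sequences, where eigenvalue relations become arithmetic
  recursions.\<close>

definition hecke_coeff ::
  "(int \<Rightarrow> complex) \<Rightarrow> nat \<Rightarrow> (nat \<Rightarrow> complex) \<Rightarrow> nat \<Rightarrow> complex" where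
  "hecke_coeff \<epsilon> l a n =
     a (n * l) + \<epsilon> (int l) * of_nat l * (if l dvd n then a (n div l) else 0)"

lemma has_q_expansion_cong:
  assumes "\<And>z. z \<in> upper_half_plane \<Longrightarrow> f z = g z"
  shows "has_q_expansion f a \<longleftrightarrow> has_q_expansion g a"
  using assms by (auto simp: has_q_expansion_def)

lemma has_q_expansion_cmult:
  "has_q_expansion f a \<Longrightarrow> has_q_expansion (\<lambda>z. c * f z) (\<lambda>n. c * a n)"
  unfolding has_q_expansion_def by (auto simp: mult.assoc intro!: sums_mult)

lemma has_q_expansion_add:
  "has_q_expansion f a \<Longrightarrow> has_q_expansion g b \<Longrightarrow> has_q_expansion (\<lambda>z. f z + g z) (\<lambda>n. a n + b n)"
  unfolding has_q_expansion_def by (auto simp: distrib_right intro!: sums_add)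

lemma has_q_expansion_zero_iff:
  assumes "has_q_expansion f a"
  shows "(\<forall>z\<in>upper_half_plane. f z = 0) \<longleftrightarrow> (\<forall>n. a n = 0)"
proof
  assume "\<forall>z\<in>upper_half_plane. f z = 0"
  then have "has_q_expansion f (\<lambda>_. 0)"
    by (simp add: has_q_expansion_def)
  with assms show "\<forall>n. a n = 0"
    using has_q_expansion_unique by metis
next
  assume *: "\<forall>n. a n = 0"
  show "\<forall>z\<in>upper_half_plane. f z = 0"
  proof
    fix z assume "z \<in> upper_half_plane"
    then have "(\<lambda>n. 0) sums f z"
      using assms * by (simp add: has_q_expansion_def)
    then show "f z = 0"
      using sums_unique2 sums_zero by blast
  qed
qed

lemma sums_multiples_iff:
  fixes F :: "nat \<Rightarrow> complex"
  assumes "0 < m" "\<And>n. \<not> m dvd n \<Longrightarrow> F n = 0"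
  shows "(\<lambda>n. F (n * m)) sums s \<longleftrightarrow> F sums s"
proof (rule sums_mono_reindex)
  show "strict_mono (\<lambda>n. n * m)"
    using assms(1) by (simp add: strict_mono_def)
  show "F n = 0" if "n \<notin> range (\<lambda>n. n * m)" for n
  proof (rule assms(2), rule notI)
    assume "m dvd n"
    then show False using that by (auto elim!: dvdE simp: mult.commute)
  qed
qed

lemma has_q_expansion_scale:
  assumes exp: "has_q_expansion f a" and m: "0 < m"
  shows "has_q_expansion (\<lambda>z. f (of_nat m * z)) (\<lambda>n. if m dvd n then a (n div m) else 0)"
  unfolding has_q_expansion_def
proof
  fix z assume "z \<in> upper_half_plane"
  then have "of_nat m * z \<in> upper_half_plane"
    using m by (simp add: upper_half_plane_def)
  then have "(\<lambda>n. a n * q_param (of_nat m * z) ^ n) sums f (of_nat m * z)"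
    using exp by (simp add: has_q_expansion_def)
  then show "(\<lambda>n. (if m dvd n then a (n div m) else 0) * q_param z ^ n) sums f (of_nat m * z)"
    using m by (subst sums_multiples_iff [OF m, symmetric])
       (simp_all add: q_param_mult mult.commute [of _ m] flip: power_mult)
qed

text \<open>A function of \<open>q\<^sup>m\<close> is invariant under \<open>z \<mapsto> z + 1 / m\<close>, so that it stays periodic with period 1 when its
  argument is divided by \<open>m\<close>.\<close>

lemma has_q_expansion_unscale:
  assumes exp: "has_q_expansion f a" and m: "0 < m"
    and supp: "\<And>n. \<not> m dvd n \<Longrightarrow> a n = 0"
  shows "has_q_expansion (\<lambda>z. f (z / of_nat m)) (\<lambda>n. a (n * m))"
  unfolding has_q_expansion_def
proof
  fix z assume "z \<in> upper_half_plane"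
  then have "z / of_nat m \<in> upper_half_plane"
    using m by (simp add: upper_half_plane_def)
  then have "(\<lambda>n. a n * q_param (z / of_nat m) ^ n) sums f (z / of_nat m)"
    using exp by (simp add: has_q_expansion_def)
  then have "(\<lambda>n. a (n * m) * q_param (z / of_nat m) ^ (n * m)) sums f (z / of_nat m)"
    by (subst sums_multiples_iff [OF m]) (simp_all add: supp)
  then show "(\<lambda>n. a (n * m) * q_param z ^ n) sums f (z / of_nat m)"
    by (simp add: q_param_divide [OF m] mult.commute [of _ m] power_mult)
qed

lemma q_param_root_power_sum:
  assumes m: "0 < m"
  shows "(\<Sum>j<m. q_param (of_nat j / of_nat m) ^ n) = (if m dvd n then of_nat m else 0)"
proof -
  define \<zeta> where "\<zeta> = q_param (of_nat n / of_nat m)"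
  have *: "q_param (of_nat j / of_nat m) ^ n = \<zeta> ^ j" for j
    by (simp add: \<zeta>_def mult_ac flip: q_param_mult)
  have "\<zeta> ^ m = q_param (of_nat n * 1)"
    using m by (simp add: \<zeta>_def q_param_divide)
  also have "\<dots> = 1"
    by (subst q_param_mult) (simp add: q_param_def)
  finally have \<zeta>_pow: "\<zeta> ^ m = 1" .
  have \<zeta>_1: "\<zeta> = 1 \<longleftrightarrow> m dvd n"
    using complex_root_unity_eq_1 [of m n] m by (simp add: \<zeta>_def q_param_def)
  show ?thesis
    unfolding * using \<zeta>_1 \<zeta>_pow by (cases "\<zeta> = 1") (auto simp: geometric_sum)
qed

text \<open>Summation over the \<open>m\<close>-th roots of unity sieves out the exponents divisible by \<open>m\<close>. This yields the
  description of \<open>T\<^sub>p\<close> as an average of translates, on which transformation behaviour can be checked,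
  and shows that \<open>\<Sum> a\<^bsub>nm\<^esub> q\<^sup>n\<close> converges.\<close>

lemma has_q_expansion_average:
  assumes exp: "has_q_expansion f a" and m: "0 < m"
  shows "has_q_expansion (\<lambda>z. (\<Sum>j<m. f ((z + of_nat j) / of_nat m)) / of_nat m) (\<lambda>n. a (n * m))"
  unfolding has_q_expansion_def
proof
  fix z assume z: "z \<in> upper_half_plane"
  define u where "u = q_param (z / of_nat m)"
  have "(\<lambda>n. a n * (u * q_param (of_nat j / of_nat m)) ^ n) sums f ((z + of_nat j) / of_nat m)" for j
  proof -
    have "(z + of_nat j) / of_nat m \<in> upper_half_plane"
      using z m by (simp add: upper_half_plane_def)
    then show ?thesis
      using exp by (simp add: has_q_expansion_def u_def add_divide_distrib flip: q_param_add)
  qed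
  then have "(\<lambda>n. \<Sum>j<m. a n * (u * q_param (of_nat j / of_nat m)) ^ n) sums
      (\<Sum>j<m. f ((z + of_nat j) / of_nat m))"
    by (intro sums_sum)
  also have "(\<lambda>n. \<Sum>j<m. a n * (u * q_param (of_nat j / of_nat m)) ^ n) =
      (\<lambda>n. a n * u ^ n * (if m dvd n then of_nat m else 0))"
    by (subst q_param_root_power_sum [OF m, symmetric])
       (simp add: power_mult_distrib sum_distrib_left mult.assoc)
  finally have "(\<lambda>n. a n * u ^ n * (if m dvd n then of_nat m else 0) / of_nat m) sums
      ((\<Sum>j<m. f ((z + of_nat j) / of_nat m)) / of_nat m)"
    by (rule sums_divide)
  then have "(\<lambda>n. a (n * m) * u ^ (n * m)) sums
      ((\<Sum>j<m. f ((z + of_nat j) / of_nat m)) / of_nat m)"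
    using m by (subst (asm) sums_multiples_iff [OF m, symmetric]) simp_all
  then show "(\<lambda>n. a (n * m) * q_param z ^ n) sums
      ((\<Sum>j<m. f ((z + of_nat j) / of_nat m)) / of_nat m)"
    by (simp add: u_def q_param_divide [OF m] mult.commute [of _ m] power_mult)
qed

lemma has_q_expansion_hecke_prime:
  assumes exp: "has_q_expansion f a" and l: "0 < l"
  shows "has_q_expansion (hecke_prime \<epsilon> l f) (hecke_coeff \<epsilon> l a)"
proof -
  have "has_q_expansion
      (\<lambda>z. (\<Sum>j<l. f ((z + of_nat j) / of_nat l)) / of_nat l +
           \<epsilon> (int l) * of_nat l * f (of_nat l * z)) (hecke_coeff \<epsilon> l a)"
    unfolding hecke_coeff_def [abs_def]
    by (intro has_q_expansion_add has_q_expansion_cmult has_q_expansion_average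
              has_q_expansion_scale exp l)
  then show ?thesis
    unfolding has_q_expansion_def hecke_prime_def q_coeff_eqI [OF exp] hecke_coeff_def
    by (blast intro: summable_sums sums_summable)
qed

lemma hecke_prime_eigen_iff:
  assumes exp: "has_q_expansion f a" and l: "0 < l"
  shows "(\<forall>z\<in>upper_half_plane. hecke_prime \<epsilon> l f z = c * f z) \<longleftrightarrow>
    (\<forall>n. hecke_coeff \<epsilon> l a n = c * a n)"
proof -
  have "has_q_expansion (\<lambda>z. hecke_prime \<epsilon> l f z + (- c) * f z)
          (\<lambda>n. hecke_coeff \<epsilon> l a n + (- c) * a n)"
    by (intro has_q_expansion_add has_q_expansion_cmult has_q_expansion_hecke_prime exp l)
  from has_q_expansion_zero_iff [OF this] show ?thesis
    by simp
qed

section \<open>Vanishing in level one and its consequences\<close>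

text \<open>The two substitutions \<open>z + 1\<close> and \<open>z / (z + 1)\<close> generate the modular group, so \<open>g\<close> is a cusp form of
  weight 2 and level 1, that is, a holomorphic differential on a curve of genus 0. The primitive
  \<open>G = \<Sum> (c\<^sub>n / n) q\<^sup>n\<close> of \<open>2 \<pi> \<i> g\<close> is invariant under the generators up to additive constants; the
  constant for \<open>z \<mapsto> - 1 / z\<close> vanishes because of the fixed point \<open>\<i>\<close>. The points
  of height \<open>3 / 4 < sqrt 3 / 2\<close> with \<open>\<bar>Re z\<bar> \<le> 1 / 2\<close> lie inside the unit circle and are moved up by
  \<open>z \<mapsto> - 1 / z\<close>, so that the maximum of \<open>\<bar>G\<bar>\<close> over all points of height at least \<open>3 / 4\<close>, the point \<open>\<i>\<infinity>\<close>
  included, is attained in the interior.\<close>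

lemma level_one_vanishing:
  assumes exp: "has_q_expansion g c" and c0: "c 0 = 0"
    and inv: "\<And>z. z \<in> upper_half_plane \<Longrightarrow> g (z / (z + 1)) = (z + 1)\<^sup>2 * g z"
  shows "c n = 0"
proof -
  \<comment> \<open>As \<open>x / 0 = 0\<close>, the primitive is normalised to vanish at \<open>\<i>\<infinity>\<close>.\<close>
  define d where "d n = c n / of_nat n" for n
  define \<Phi> where "\<Phi> w = (\<Sum>n. d n * w ^ n)" for w
  define \<Phi>' where "\<Phi>' w = (\<Sum>n. diffs d n * w ^ n)" for w
  define G where "G z = \<Phi> (q_param z)" for z
  have d_le: "norm (d n) \<le> norm (c n)" for n
    by (cases "n = 0") (auto simp: d_def c0 norm_divide divide_le_eq mult_left_le mult_le_cancel_left1)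
  have summ: "summable (\<lambda>n. d n * w ^ n)" if "norm w < 1" for w
    by (rule summable_comparison_test' [OF has_q_expansion_summable_norm [OF exp that], of 0])
       (simp add: norm_mult mult_right_mono d_le)
  have \<Phi>_deriv: "(\<Phi> has_field_derivative \<Phi>' w) (at w)" if "norm w < 1" for w
    unfolding \<Phi>_def [abs_def] \<Phi>'_def by (rule termdiffs_strong' [OF summ that])
  have \<Phi>'_q: "\<Phi>' (q_param z) * q_param z = g z" if "z \<in> upper_half_plane" for z
  proof -
    have "(\<lambda>n. diffs d n * q_param z ^ n) sums \<Phi>' (q_param z)"
      unfolding \<Phi>'_def using norm_q_param_less_1 [OF that]
      by (intro summable_sums termdiff_converges [where K = 1] summ) auto
    then have "(\<lambda>n. diffs d n * q_param z ^ n * q_param z) sums (\<Phi>' (q_param z) * q_param z)"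
      by (rule sums_mult2)
    moreover have "diffs d n * q_param z ^ n * q_param z = c (Suc n) * q_param z ^ Suc n" for n
      using of_nat_neq_0 [of n, where ?'a = complex] by (simp add: diffs_def d_def field_simps del: of_nat_Suc)
    ultimately have "(\<lambda>n. c (Suc n) * q_param z ^ Suc n) sums (\<Phi>' (q_param z) * q_param z)"
      by simp
    then have "(\<lambda>n. c n * q_param z ^ n) sums (\<Phi>' (q_param z) * q_param z)"
      by (subst (asm) sums_Suc_iff) (simp add: c0)
    moreover have "(\<lambda>n. c n * q_param z ^ n) sums g z"
      using exp that by (simp add: has_q_expansion_def)
    ultimately show ?thesis
      by (rule sums_unique2)
  qed
  have G_deriv: "(G has_field_derivative 2 * pi * \<i> * g z) (at z)" if "z \<in> upper_half_plane" for z
  proof -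
    have "(q_param has_field_derivative 2 * pi * \<i> * q_param z) (at z)"
      unfolding q_param_def [abs_def] by (auto intro!: derivative_eq_intros)
    from DERIV_chain2 [OF \<Phi>_deriv [OF norm_q_param_less_1 [OF that]] this]
    show ?thesis
      unfolding G_def [abs_def] by (simp flip: \<Phi>'_q [OF that] add: mult_ac)
  qed
  have G_per: "G (z + 1) = G z" for z
    by (simp add: G_def q_param_add_1)
  have "\<exists>\<kappa>. \<forall>z\<in>upper_half_plane. G (z / (z + 1)) - G z = \<kappa>"
  proof -
    have "((\<lambda>z. G (z / (z + 1)) - G z) has_field_derivative 0) (at z)"
      if z: "z \<in> upper_half_plane" for z
    proof -
      have nz: "z + 1 \<noteq> 0"
        using z by (auto simp: upper_half_plane_def complex_eq_iff)
      have 1: "((\<lambda>z. z / (z + 1)) has_field_derivative 1 / (z + 1)\<^sup>2) (at z)"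
        using nz by (auto intro!: derivative_eq_intros simp: power2_eq_square)
      have "z / (z + 1) \<in> upper_half_plane"
        using z nz by (simp add: upper_half_plane_def Im_divide field_simps sum_power2_gt_zero_iff complex_eq_iff)
      from DERIV_diff [OF DERIV_chain2 [OF G_deriv [OF this] 1] G_deriv [OF z]]
      show ?thesis
        using nz by (simp add: inv [OF z])
    qed
    moreover have "convex upper_half_plane"
      unfolding upper_half_plane_def by (simp add: convex_halfspace_Im_gt)
    ultimately show ?thesis
      by (intro has_field_derivative_zero_constant) (auto intro: has_field_derivative_at_within)
  qed
  then obtain \<kappa> where \<kappa>: "\<And>z. z \<in> upper_half_plane \<Longrightarrow> G (z / (z + 1)) = G z + \<kappa>"
    by (auto simp: algebra_simps)
  \<comment> \<open>Translating \<open>z\<close> by \<open>-1\<close>, applying \<open>z / (z + 1)\<close> and translating by \<open>-1\<close> again gives \<open>- 1 / z\<close>.\<close>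
  have G_S: "G (- 1 / z) = G z + \<kappa>" if "z \<in> upper_half_plane" for z
  proof -
    have "z - 1 \<in> upper_half_plane" and nz: "z \<noteq> 0"
      using that by (auto simp: upper_half_plane_def)
    then have "G ((z - 1) / z) = G (z - 1) + \<kappa>"
      using \<kappa> [of "z - 1"] by simp
    moreover have "(z - 1) / z = - 1 / z + 1"
      using nz by (simp add: field_simps)
    ultimately show ?thesis
      using G_per [of "z - 1"] G_per [of "- 1 / z"] by simp
  qed
  have "\<kappa> = 0"
    using G_S [of \<i>] by (simp add: upper_half_plane_def)
  \<comment> \<open>The disc of radius \<open>r\<close> consists of the q-parameters of points of height at least \<open>3 / 4\<close>.\<close>
  define r where "r = exp (- (2 * pi * (3 / 4)))"
  have r: "0 < r" "r < 1"
    by (auto simp: r_def)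
  have \<Phi>_hol: "\<Phi> holomorphic_on ball 0 1"
    using \<Phi>_deriv unfolding holomorphic_on_open [OF open_ball] Ball_def mem_ball_0 by blast
  obtain w where w: "w \<in> cball 0 r" "\<And>v. v \<in> cball 0 r \<Longrightarrow> norm (\<Phi> v) \<le> norm (\<Phi> w)"
  proof -
    have "continuous_on (cball 0 r) (\<lambda>v. norm (\<Phi> v))"
      using r by (intro continuous_on_norm holomorphic_on_imp_continuous_on holomorphic_on_subset [OF \<Phi>_hol]) auto
    then show ?thesis
      using continuous_attains_sup [of "cball (0::complex) r"] r that by force
  qed
  obtain v where v: "v \<in> ball 0 r" "norm (\<Phi> v) = norm (\<Phi> w)"
  proof (cases "norm w < r")
    case False
    then have nw: "norm w = r" using w by simp
    have "w \<noteq> 0" "norm w < 1" using nw r by auto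
    then obtain z0 where z0: "z0 \<in> upper_half_plane" "q_param z0 = w"
      using q_param_onto by blast
    define z where "z = z0 - of_int (round (Re z0))"
    have "q_param (of_int (round (Re z0))) = 1"
      by (auto simp: q_param_def exp_eq_1)
    then have qz: "q_param z = w"
      using z0 q_param_add [of z "of_int (round (Re z0))"] by (simp add: z_def)
    have "\<bar>Re z\<bar> \<le> 1 / 2"
      using of_int_round_abs_le [of "Re z0"] by (simp add: z_def abs_minus_commute)
    then have "\<bar>Re z\<bar> ^ 2 \<le> (1 / 2) ^ 2" by (rule power_mono) simp
    moreover have Imz: "Im z = 3 / 4"
      using nw qz norm_q_param [of z] by (simp add: r_def)
    ultimately have n1: "(Re z)\<^sup>2 + (Im z)\<^sup>2 < 1"
      unfolding Imz by (simp add: power2_eq_square)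
    have z: "z \<in> upper_half_plane"
      using Imz by (simp add: upper_half_plane_def)
    have "Im (- 1 / z) = Im z / ((Re z)\<^sup>2 + (Im z)\<^sup>2)"
      by (simp add: Im_divide)
    moreover have "(Re z)\<^sup>2 + (Im z)\<^sup>2 > 0" using Imz by (simp add: sum_power2_gt_zero_iff)
    ultimately have "Im (- 1 / z) > 3 / 4"
      using n1 Imz by (simp add: less_divide_eq)
    then have "2 * pi * (3 / 4) < 2 * pi * Im (- 1 / z)"
      by (intro mult_strict_left_mono) auto
    then have "q_param (- 1 / z) \<in> ball 0 r"
      by (simp only: mem_ball_0 norm_q_param r_def exp_less_cancel_iff neg_less_iff_less)
    moreover have "\<Phi> (q_param (- 1 / z)) = \<Phi> w"
      using G_S [OF z] \<open>\<kappa> = 0\<close> by (simp add: G_def qz)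
    ultimately show ?thesis using that by metis
  qed (use that in auto)
  have "\<Phi> constant_on ball 0 1"
    using v w r
    by (intro maximum_modulus_principle [OF \<Phi>_hol, where U = "ball 0 r" and \<xi> = v]) auto
  then obtain C where C: "\<And>u. u \<in> ball 0 1 \<Longrightarrow> \<Phi> u = C"
    by (auto simp: constant_on_def)
  have "\<Phi> 0 = 0"
    by (simp add: \<Phi>_def powser_zero) (simp add: d_def)
  then have "\<Phi> u = 0" if "norm u < 1" for u
    using C [of 0] C [of u] that by simp
  then have "(\<lambda>n. d n * u ^ n) sums 0" if "norm u < 1" for u
    using summable_sums [OF summ [OF that]] that by (simp add: \<Phi>_def)
  then have "d n = 0"
    by (intro power_series_zero_off_centre) auto
  then show "c n = 0"
    using c0 by (cases "n = 0") (auto simp: d_def)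
qed

text \<open>This is what excludes oldforms. Rescaling \<open>z\<close> by \<open>N\<close> turns the substitution \<open>z / (N z + 1)\<close> into
  \<open>z / (z + 1)\<close>, while the support condition keeps the rescaled function periodic with period 1, so it
  has level 1.\<close>

lemma vanishing_if_supported_on_multiples:
  assumes exp: "has_q_expansion h b" and N: "0 < N"
    and b0: "b 0 = 0" and supp: "\<And>n. \<not> N dvd n \<Longrightarrow> b n = 0"
    and inv: "\<And>z. z \<in> upper_half_plane \<Longrightarrow>
      h (z / (of_nat N * z + 1)) = (of_nat N * z + 1)\<^sup>2 * h z"
  shows "b n = 0"
proof (cases "N dvd n")
  case True
  have "has_q_expansion (\<lambda>z. h (z / of_nat N)) (\<lambda>n. b (n * N))"
    using exp N supp by (rule has_q_expansion_unscale)
  moreover have "h (z / (z + 1) / of_nat N) = (z + 1)\<^sup>2 * h (z / of_nat N)"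
    if "z \<in> upper_half_plane" for z
  proof -
    have "z / of_nat N \<in> upper_half_plane"
      using that N by (simp add: upper_half_plane_def)
    from inv [OF this] show ?thesis
      using N by (simp add: mult.commute)
  qed
  ultimately have "b (m * N) = 0" for m
    using level_one_vanishing [of "\<lambda>z. h (z / of_nat N)" "\<lambda>n. b (n * N)"] b0 by simp
  then show ?thesis
    using True by (metis dvd_def mult.commute)
qed (rule supp)

text \<open>Peeling one prime \<open>l \<noteq> p\<close> after another off \<open>n\<close>, the relation
  \<open>b\<^bsub>ml\<^esub> = \<lambda>\<^sub>l b\<^sub>m - \<epsilon>(l) l b\<^bsub>m/l\<^esub>\<close> expresses \<open>b\<^sub>n\<close> as a multiple of \<open>b\<^sub>1\<close>.\<close>

lemma hecke_coeff_eigen_vanishing: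
  fixes p :: nat
  assumes eigen: "\<And>l n. Factorial_Ring.prime l \<Longrightarrow> l \<noteq> p \<Longrightarrow> hecke_coeff \<epsilon> l b n = lam l * b n"
    and b1: "b 1 = 0" and n: "\<not> p dvd n"
  shows "b n = 0"
  using n
proof (induction n rule: less_induct)
  case (less n)
  show ?case
  proof (cases "n = 1")
    case False
    then obtain l where l: "Factorial_Ring.prime l" "l dvd n"
      using prime_factor_nat by blast
    then obtain m where m: "n = m * l" by (auto simp: mult.commute)
    have "n \<noteq> 0" using less.prems by (metis dvd_0_right)
    have "l \<noteq> p" "\<not> p dvd m"
      using less.prems l m by auto
    have "l > 1" using l prime_gt_1_nat by blast
    have "m < n" "m > 0" using m \<open>l > 1\<close> \<open>n \<noteq> 0\<close> by auto
    have "b m = 0" using less.IH \<open>m < n\<close> \<open>\<not> p dvd m\<close> by blast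
    moreover have "b (m div l) = 0" if "l dvd m"
    proof (rule less.IH)
      show "m div l < n" using \<open>m < n\<close> by (meson div_le_dividend le_less_trans)
      show "\<not> p dvd m div l"
        using that \<open>\<not> p dvd m\<close> by (metis dvd_mult2 dvd_div_mult_self)
    qed
    ultimately show ?thesis
      using eigen [OF l(1) \<open>l \<noteq> p\<close>, of m] by (auto simp: hecke_coeff_def m split: if_splits)
  qed (use b1 in simp)
qed

section \<open>Eigenforms at the level\<close>

lemma cusp_form2_q_expansion:
  assumes f: "cusp_form2_Gamma1 N f"
  obtains a where "a 0 = 0" "has_q_expansion f a"
proof -
  have hol: "f holomorphic_on upper_half_plane"
    using f by (simp add: cusp_form2_Gamma1_def)
  have per: "f (z + 1) = f z" if "z \<in> upper_half_plane" for z
  proof -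
    have "(1, 1, 0, 1) \<in> Gamma1 N"
      by (simp add: Gamma1_def Gamma0_def SL2Z_def)
    then have "slash2 f (1, 1, 0, 1) z = f z"
      using f that unfolding cusp_form2_Gamma1_def by blast
    then show ?thesis by simp
  qed
  have "(1, 0, 0, 1) \<in> SL2Z"
    by (simp add: SL2Z_def)
  then have "(slash2 f (1, 0, 0, 1) \<longlongrightarrow> 0) (filtercomap Im at_top)"
    using f unfolding cusp_form2_Gamma1_def vanishes_at_cusps_def by blast
  moreover have "slash2 f (1, 0, 0, 1) = f"
    by (rule ext) simp
  ultimately have lim: "(f \<longlongrightarrow> 0) (filtercomap Im at_top)"
    by simp
  show thesis
    by (rule q_expansion_exists [OF hol _ lim]) (simp add: per, rule that)
qed

text \<open>Moving the substitution past the matrix with rows \<open>(1, j)\<close>, \<open>(0, N)\<close> replaces the matrix with rows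
  \<open>(1, 0)\<close>, \<open>(N, 1)\<close> by the matrix \<open>\<gamma>\<close> below, which again lies in \<open>\<Gamma>\<^sub>1(N)\<close>. Thus each summand of the average
  that computes \<open>T\<^sub>p f\<close> transforms separately, without a permutation of the summands.\<close>

lemma cusp_form2_translate_lower_unipotent:
  assumes f: "cusp_form2_Gamma1 N f" and N: "0 < N" and z: "z \<in> upper_half_plane"
  shows "f ((z / (of_nat N * z + 1) + of_nat j) / of_nat N) =
    (of_nat N * z + 1)\<^sup>2 * f ((z + of_nat j) / of_nat N)"
proof -
  define n :: complex where "n = of_nat N"
  define J :: complex where "J = of_nat j"
  define \<gamma> :: mat2 where
    "\<gamma> = (1 + int N * int j, - (int j * int j), int N * int N, 1 - int N * int j)"
  have "\<gamma> \<in> Gamma1 N"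
    by (auto simp: \<gamma>_def Gamma1_def Gamma0_def SL2Z_def algebra_simps)
  moreover have "(z + J) / n \<in> upper_half_plane"
    using z N by (simp add: n_def J_def upper_half_plane_def)
  ultimately have eq: "slash2 f \<gamma> ((z + J) / n) = f ((z + J) / n)"
    using f unfolding cusp_form2_Gamma1_def by blast
  have n0: "n \<noteq> 0" using N by (simp add: n_def)
  have nz: "n * z + 1 \<noteq> 0"
    using z N by (auto simp: n_def upper_half_plane_def complex_eq_iff)
  have den: "n * n * ((z + J) / n) + (1 - n * J) = n * z + 1"
    using n0 by (simp add: field_simps)
  have num: "(1 + n * J) * ((z + J) / n) + (- (J * J)) = (z + J * (n * z + 1)) / n"
    using n0 by (simp add: field_simps)
  have "slash2 f \<gamma> ((z + J) / n) =
      f (((1 + n * J) * ((z + J) / n) + (- (J * J))) / (n * n * ((z + J) / n) + (1 - n * J)))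
        / (n * n * ((z + J) / n) + (1 - n * J)) ^ 2"
    by (simp add: \<gamma>_def n_def J_def)
  also have "\<dots> = f ((z + J * (n * z + 1)) / n / (n * z + 1)) / (n * z + 1)\<^sup>2"
    by (simp only: den num)
  also have "(z + J * (n * z + 1)) / n / (n * z + 1) = (z / (n * z + 1) + J) / n"
    using n0 nz by (simp add: field_simps)
  finally have "f ((z / (n * z + 1) + J) / n) = (n * z + 1)\<^sup>2 * f ((z + J) / n)"
    using eq nz by (simp add: field_simps)
  then show ?thesis
    by (simp add: n_def J_def)
qed

lemma cusp_form2_lower_unipotent:
  assumes f: "cusp_form2_Gamma1 N f" and z: "z \<in> upper_half_plane"
  shows "f (z / (of_nat N * z + 1)) = (of_nat N * z + 1)\<^sup>2 * f z"
proof -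
  have "(1, 0, int N, 1) \<in> Gamma1 N"
    by (simp add: Gamma1_def Gamma0_def SL2Z_def)
  then have "slash2 f (1, 0, int N, 1) z = f z"
    using f z unfolding cusp_form2_Gamma1_def by blast
  moreover have "of_nat N * z + 1 \<noteq> 0"
    using z by (cases "N = 0") (auto simp: upper_half_plane_def complex_eq_iff)
  ultimately show ?thesis
    by (simp add: field_simps)
qed

text \<open>If \<open>a\<^sub>1 = 0\<close>, all coefficients of index prime to \<open>p\<close> would vanish, and \<open>f\<close> would come from level 1.\<close>

lemma hecke_eigen_coeff_1_nonzero:
  assumes p: "Factorial_Ring.prime p" and f: "cusp_form2_Gamma1 p f"
    and exp: "has_q_expansion f a" and a0: "a 0 = 0"
    and nonzero: "\<exists>z\<in>upper_half_plane. f z \<noteq> 0"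
    and eigen: "\<And>l n. Factorial_Ring.prime l \<Longrightarrow> l \<noteq> p \<Longrightarrow> hecke_coeff \<epsilon> l a n = lam l * a n"
  shows "a 1 \<noteq> 0"
proof
  assume "a 1 = 0"
  then have "a n = 0" if "\<not> p dvd n" for n
    using hecke_coeff_eigen_vanishing [of p \<epsilon> a lam] eigen that by blast
  then have "a n = 0" for n
    using vanishing_if_supported_on_multiples [OF exp] prime_gt_0_nat [OF p] a0 cusp_form2_lower_unipotent [OF f] by blast
  then show False
    using has_q_expansion_zero_iff [OF exp] nonzero by blast
qed

text \<open>Forming \<open>n \<mapsto> a\<^bsub>np\<^esub>\<close> commutes with \<open>T\<^sub>l\<close> for \<open>l \<noteq> p\<close>. So \<open>h = \<Sum> (a\<^bsub>np\<^esub> - \<alpha> a\<^sub>n) q\<^sup>n\<close> has the same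
  eigenvalues as \<open>f\<close>, and \<open>\<alpha> = a\<^sub>p / a\<^sub>1\<close> is the choice for which its first coefficient vanishes.
  Hence \<open>h = 0\<close>.\<close>

lemma hecke_eigen_at_level:
  assumes p: "Factorial_Ring.prime p" and f: "cusp_form2_Gamma1 p f"
    and exp: "has_q_expansion f a" and a0: "a 0 = 0" and a1: "a 1 \<noteq> 0"
    and eigen: "\<And>l n. Factorial_Ring.prime l \<Longrightarrow> l \<noteq> p \<Longrightarrow> hecke_coeff \<epsilon> l a n = lam l * a n"
  shows "a (n * p) = a p / a 1 * a n"
proof -
  define \<alpha> where "\<alpha> = a p / a 1"
  define b where "b n = a (n * p) + (- \<alpha>) * a n" for n
  define h where "h z = (\<Sum>j<p. f ((z + of_nat j) / of_nat p)) / of_nat p + (- \<alpha>) * f z" for z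
  have p0: "0 < p" using p prime_gt_0_nat by blast
  have exp_h: "has_q_expansion h b"
    unfolding h_def [abs_def] b_def [abs_def]
    by (intro has_q_expansion_add has_q_expansion_cmult has_q_expansion_average exp p0)
  have inv_h: "h (z / (of_nat p * z + 1)) = (of_nat p * z + 1)\<^sup>2 * h z"
    if "z \<in> upper_half_plane" for z
    unfolding h_def cusp_form2_lower_unipotent [OF f that] cusp_form2_translate_lower_unipotent [OF f p0 that]
      sum_distrib_left [symmetric]
    by (simp add: algebra_simps)
  have eigen_b: "hecke_coeff \<epsilon> l b n = lam l * b n" if l: "Factorial_Ring.prime l" "l \<noteq> p" for l n
  proof -
    have "coprime l p" using primes_coprime l p by blast
    then have dvd: "l dvd n * p \<longleftrightarrow> l dvd n"
      by (simp add: coprime_dvd_mult_left_iff)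
    have "n * p div l = n div l * p" if "l dvd n"
      using that by (metis div_mult_swap mult.commute)
    then have "hecke_coeff \<epsilon> l b n = hecke_coeff \<epsilon> l a (n * p) + (- \<alpha>) * hecke_coeff \<epsilon> l a n"
      by (auto simp: hecke_coeff_def b_def dvd algebra_simps)
    also have "\<dots> = lam l * b n"
      unfolding eigen [OF l] by (simp add: b_def algebra_simps)
    finally show ?thesis .
  qed
  have "b 1 = 0" using a1 by (simp add: b_def \<alpha>_def)
  then have "b n = 0" if "\<not> p dvd n" for n
    using hecke_coeff_eigen_vanishing [of p \<epsilon> b lam] eigen_b that by blast
  moreover have "b 0 = 0" by (simp add: b_def a0)
  ultimately have "b n = 0"
    using vanishing_if_supported_on_multiples [OF exp_h p0] inv_h by blast
  then show ?thesis by (simp add: b_def \<alpha>_def)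
qed

section \<open>From prime to arbitrary Hecke operators\<close>

lemma hecke_coeff_cmult: "hecke_coeff \<epsilon> l (\<lambda>n. \<kappa> * a n) n = \<kappa> * hecke_coeff \<epsilon> l a n"
  by (simp add: hecke_coeff_def algebra_simps)

text \<open>Hecke operators of composite index are iterated, and their intermediate results agree with multiples
  of \<open>f\<close> on the upper half-plane only. Therefore the operators are evaluated on an arbitrary function \<open>g\<close>
  with that property.\<close>

lemma hecke_prime_on_multiple:
  assumes exp: "has_q_expansion f a" and l: "0 < l"
    and eigen: "\<And>n. hecke_coeff \<epsilon> l a n = c * a n"
    and g: "\<And>z. z \<in> upper_half_plane \<Longrightarrow> g z = \<kappa> * f z" and z: "z \<in> upper_half_plane"
  shows "hecke_prime \<epsilon> l g z = c * \<kappa> * f z"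
proof -
  have expg: "has_q_expansion g (\<lambda>n. \<kappa> * a n)"
    using has_q_expansion_cmult [OF exp] g by (subst has_q_expansion_cong [of g]) auto
  have "hecke_coeff \<epsilon> l (\<lambda>n. \<kappa> * a n) n = c * (\<kappa> * a n)" for n
    using eigen [of n] by (simp add: hecke_coeff_cmult mult.left_commute)
  with hecke_prime_eigen_iff [OF expg l, of \<epsilon> c] z g show ?thesis
    by simp
qed

text \<open>The recursion of \<open>T\<^bsub>l^r\<^esub>\<close> in \<open>r\<close> is the eigenvalue relation of \<open>T\<^sub>l\<close> at the index \<open>l\<^bsup>r+1\<^esup>\<close>.\<close>

lemma hecke_prime_power_on_multiple:
  assumes exp: "has_q_expansion f a" and a1: "a 1 \<noteq> 0" and l: "Factorial_Ring.prime l"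
    and eigen: "\<And>n. hecke_coeff \<epsilon> l a n = c * a n"
    and g: "\<And>z. z \<in> upper_half_plane \<Longrightarrow> g z = \<kappa> * f z" and z: "z \<in> upper_half_plane"
  shows "hecke_prime_power \<epsilon> l r g z = a (l ^ r) / a 1 * \<kappa> * f z"
  using z
proof (induction r arbitrary: z rule: induct_nat_012)
  case 0
  then show ?case using a1 g by simp
next
  case 1
  have "a l = c * a 1"
    using eigen [of 1] l by (simp add: hecke_coeff_def prime_nat_iff)
  with hecke_prime_on_multiple [OF exp prime_gt_0_nat [OF l] eigen g 1] a1 show ?case
    by simp
next
  case (ge2 r)
  have "hecke_prime_power \<epsilon> l (Suc (Suc r)) g z =
      c * (a (l ^ Suc r) / a 1 * \<kappa>) * f z - of_nat l * \<epsilon> (int l) * (a (l ^ r) / a 1 * \<kappa> * f z)"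
    using hecke_prime_on_multiple [OF exp prime_gt_0_nat [OF l] eigen ge2.IH(2) ge2.prems]
    by (simp only: hecke_prime_power.simps ge2.IH(1) [OF ge2.prems])
  also have "\<dots> = (c * a (l ^ Suc r) - \<epsilon> (int l) * of_nat l * a (l ^ r)) / a 1 * \<kappa> * f z"
    by (simp add: diff_divide_distrib algebra_simps)
  also have "c * a (l ^ Suc r) - \<epsilon> (int l) * of_nat l * a (l ^ r) = a (l ^ Suc (Suc r))"
    using eigen [of "l ^ Suc r"] prime_gt_0_nat [OF l]
    by (simp add: hecke_coeff_def mult_ac eq_diff_eq [symmetric])
  finally show ?case .
qed

text \<open>For fixed \<open>m\<close> prime to \<open>l\<close>, both sides satisfy the same second-order recursion in \<open>r\<close> with the same
  initial values.\<close>

lemma hecke_eigen_coeff_mult_prime_power: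
  assumes l: "Factorial_Ring.prime l" and eigen: "\<And>n. hecke_coeff \<epsilon> l a n = c * a n"
    and m: "\<not> l dvd m"
  shows "a (l ^ r * m) * a 1 = a (l ^ r) * a m"
proof (induction r rule: induct_nat_012)
  case 0
  show ?case by simp
next
  case 1
  have "a l = c * a 1" "a (l * m) = c * a m"
    using eigen [of 1] eigen [of m] l m by (simp_all add: hecke_coeff_def prime_nat_iff mult.commute)
  then show ?case by simp
next
  case (ge2 r)
  have step: "a (l ^ Suc (Suc r) * k) =
      c * a (l ^ Suc r * k) - \<epsilon> (int l) * of_nat l * a (l ^ r * k)" for k
  proof -
    have "l ^ Suc r * k * l = l ^ Suc (Suc r) * k" "l ^ Suc r * k div l = l ^ r * k"
      "l dvd l ^ Suc r * k"
      using prime_gt_0_nat [OF l] by (simp_all add: mult_ac)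
    with eigen [of "l ^ Suc r * k"] show ?thesis
      by (simp add: hecke_coeff_def eq_diff_eq del: power_Suc)
  qed
  show ?case
    using step [of m] step [of 1] ge2 by (simp only: mult_1_right left_diff_distrib mult.assoc)
qed

text \<open>Induction over the prime divisors of \<open>n\<close>, applied one at a time as in the definition of \<open>T\<^sub>n\<close>; by
  multiplicativity of \<open>a\<^sub>n / a\<^sub>1\<close> the eigenvalue collected so far is that of the partial product.\<close>

lemma hecke_eigenvalue_of_primes:
  assumes exp: "has_q_expansion f a" and a1: "a 1 \<noteq> 0"
    and eigen: "\<And>l n. Factorial_Ring.prime l \<Longrightarrow> hecke_coeff \<epsilon> l a n = c l * a n"
    and n: "1 \<le> n"
  shows "hecke_eigenvalue \<epsilon> n f (a n / a 1)"
proof -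
  define e where "e l = multiplicity l n" for l
  define T where "T ls = foldr (\<lambda>l. hecke_prime_power \<epsilon> l (e l)) ls f" for ls
  define N where "N ls = (\<Prod>l\<in>set ls. l ^ e l)" for ls
  have "\<forall>z\<in>upper_half_plane. T ls z = a (N ls) / a 1 * f z"
    if "distinct ls" "\<forall>l\<in>set ls. Factorial_Ring.prime l" for ls
    using that
  proof (induction ls)
    case Nil
    then show ?case using a1 by (simp add: T_def N_def)
  next
    case (Cons l ls)
    have l: "Factorial_Ring.prime l" using Cons.prems by simp
    have IH: "T ls z = a (N ls) / a 1 * f z" if "z \<in> upper_half_plane" for z
      using Cons that by simp
    have "\<not> l dvd N ls"
    proof
      assume "l dvd N ls"
      then obtain l' where l': "l' \<in> set ls" "l dvd l' ^ e l'"
        using prime_dvd_prod_iff [OF _ l, of "set ls"] by (auto simp: N_def)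
      then have "l dvd l'" using prime_dvd_power [OF l] by blast
      then have "l = l'" using l l'(1) Cons.prems primes_dvd_imp_eq by (metis list.set_intros(2))
      then show False using l' Cons.prems by simp
    qed
    then have mult: "a (l ^ e l * N ls) * a 1 = a (l ^ e l) * a (N ls)"
      using hecke_eigen_coeff_mult_prime_power [OF l eigen [OF l]] by blast
    show ?case
    proof
      fix z assume z: "z \<in> upper_half_plane"
      have "T (l # ls) z = hecke_prime_power \<epsilon> l (e l) (T ls) z"
        by (simp add: T_def)
      also have "\<dots> = a (l ^ e l) / a 1 * (a (N ls) / a 1) * f z"
        by (rule hecke_prime_power_on_multiple [OF exp a1 l eigen [OF l] IH z])
      also have "\<dots> = a (N (l # ls)) / a 1 * f z"
        using mult a1 Cons.prems(1) by (simp add: N_def field_simps)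
      finally show "T (l # ls) z = a (N (l # ls)) / a 1 * f z" .
    qed
  qed
  from this [of "sorted_list_of_set (prime_factors n)"]
  have "\<forall>z\<in>upper_half_plane. T (sorted_list_of_set (prime_factors n)) z =
      a (N (sorted_list_of_set (prime_factors n))) / a 1 * f z"
    by auto
  moreover have "N (sorted_list_of_set (prime_factors n)) = n"
  proof -
    have "N (sorted_list_of_set (prime_factors n)) = (\<Prod>l\<in>prime_factors n. l ^ e l)"
      by (simp add: N_def)
    also have "\<dots> = n"
      unfolding e_def using n by (intro prime_factorization_nat [symmetric]) simp
    finally show ?thesis .
  qed
  ultimately show ?thesis
    by (simp add: hecke_eigenvalue_def hecke_def T_def e_def)
qed

theorem proposition5p2:
  fixes p k :: nat
    and P K L PL :: "complex set"
    and w \<epsilon> :: "int \<Rightarrow> complex"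
    and f :: "complex \<Rightarrow> complex"
    and lam :: "nat \<Rightarrow> complex"
  assumes "Factorial_Ring.prime p" and "odd p"
    and "K = cyclotomic_field (p - 1)" and "prime_above p K P"
    and "teichmuller_char p P w"
    and "even k" and "2 \<le> k" and "k + 3 \<le> p"
    and "int p dvd fst (quotient_of (bernoulli k))"
    and "\<epsilon> = char_power p w (k - 2)"
    and "cusp_form2 p \<epsilon> f" and "\<exists>z\<in>upper_half_plane. f z \<noteq> 0"
    and "\<And>n. n \<ge> 1 \<Longrightarrow> coprime n p \<Longrightarrow> hecke_eigenvalue \<epsilon> n f (lam n)"
    and "L = generate_field complex_ring (K \<union> {lam n |n. n \<ge> 1 \<and> coprime n p})"
    and "prime_lies_over K P L PL"
    and "\<And>l. Factorial_Ring.prime l \<Longrightarrow> l \<noteq> p \<Longrightarrow>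
           cong_ideal (lam l) (1 + of_nat l ^ (k - 1)) PL \<and>
           cong_ideal (1 + of_nat l ^ (k - 1)) (1 + \<epsilon> (int l) * of_nat l) PL"
  shows "\<exists>mu :: nat \<Rightarrow> complex.
           (\<forall>n\<ge>1. hecke_eigenvalue \<epsilon> n f (mu n)) \<and>
           (\<exists>c. c \<noteq> 0 \<and>
              (\<forall>n\<ge>1. hecke_eigenvalue \<epsilon> n (\<lambda>z. c * f z) (mu n)) \<and>
              (\<forall>z\<in>upper_half_plane.
                 (\<lambda>n. mu (Suc n) * q_param z ^ Suc n) sums (c * f z)))"
proof -
  note p = \<open>Factorial_Ring.prime p\<close>
  have f: "cusp_form2_Gamma1 p f"
    using \<open>cusp_form2 p \<epsilon> f\<close> by (simp add: cusp_form2_def)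
  obtain a where a0: "a 0 = 0" and exp: "has_q_expansion f a"
    using cusp_form2_q_expansion [OF f] .
  have eigen: "hecke_coeff \<epsilon> l a n = lam l * a n" if l: "Factorial_Ring.prime l" "l \<noteq> p" for l n
  proof -
    have "coprime l p" using primes_coprime l p by blast
    then have "hecke_eigenvalue \<epsilon> l f (lam l)"
      using assms(13) l prime_ge_1_nat by blast
    moreover have "hecke \<epsilon> l f = hecke_prime \<epsilon> l f"
      using hecke_prime_pow [OF l(1), of \<epsilon> 1 f] by simp
    ultimately have "\<forall>z\<in>upper_half_plane. hecke_prime \<epsilon> l f z = lam l * f z"
      by (simp add: hecke_eigenvalue_def)
    then show ?thesis
      using hecke_prime_eigen_iff [OF exp prime_gt_0_nat [OF l(1)]] by blast
  qed
  have a1: "a 1 \<noteq> 0"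
    using hecke_eigen_coeff_1_nonzero [OF p f exp a0 assms(12) eigen] by blast
  \<comment> \<open>The second term of \<open>T\<^sub>p\<close> disappears, so \<open>T\<^sub>p f\<close> has the coefficients \<open>a (n * p)\<close>.\<close>
  have "\<epsilon> (int p) = 0"
    using p prime_gt_1_nat [OF p] by (simp add: \<open>\<epsilon> = _\<close> char_power_def)
  then have eigen_p: "hecke_coeff \<epsilon> p a n = a p / a 1 * a n" for n
    using hecke_eigen_at_level [OF p f exp a0 a1 eigen, of n] by (simp add: hecke_coeff_def)
  define c where "c l = (if l = p then a p / a 1 else lam l)" for l
  have all: "hecke_coeff \<epsilon> l a n = c l * a n" if "Factorial_Ring.prime l" for l n
    using eigen [OF that] eigen_p by (simp add: c_def)
  \<comment> \<open>The coefficients of the normalised form are at the same time the eigenvalues.\<close>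
  define b where "b n = 1 / a 1 * a n" for n
  have b1: "b 1 = 1" using a1 by (simp add: b_def)
  have exp_b: "has_q_expansion (\<lambda>z. 1 / a 1 * f z) b"
    unfolding b_def [abs_def] using exp by (rule has_q_expansion_cmult)
  have all_b: "hecke_coeff \<epsilon> l b n = c l * b n" if "Factorial_Ring.prime l" for l n
    unfolding b_def [abs_def] hecke_coeff_cmult all [OF that] by simp
  show ?thesis
  proof (intro exI [of _ b] exI [of _ "1 / a 1"] conjI allI impI ballI)
    fix n :: nat assume n: "1 \<le> n"
    show "hecke_eigenvalue \<epsilon> n f (b n)"
      using hecke_eigenvalue_of_primes [OF exp a1 all n] by (simp add: b_def)
    show "hecke_eigenvalue \<epsilon> n (\<lambda>z. 1 / a 1 * f z) (b n)"
      using hecke_eigenvalue_of_primes [OF exp_b _ all_b n] b1 by simp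
  next
    show "1 / a 1 \<noteq> 0" using a1 by simp
  next
    fix z assume "z \<in> upper_half_plane"
    then have "(\<lambda>n. b n * q_param z ^ n) sums (1 / a 1 * f z)"
      using exp_b by (simp add: has_q_expansion_def)
    then show "(\<lambda>n. b (Suc n) * q_param z ^ Suc n) sums (1 / a 1 * f z)"
      by (subst sums_Suc_iff) (simp add: b_def a0)
  qed
qed

end
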